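(* Let $M\subset\mathbb{R}^n$ be a full submanifold which is a helix with respect to the direction $d=\cos(\theta)T+\sin(\theta)\xi$ ($\theta\neq 0$). Then $M$ is a ruled helix if and only if the normal curvatures of the helix lines of $M$ with respect to $d$ equal zero.
   Context: All submanifolds, curves and vector fields are smooth; $\mathbb{R}^n$ has its Euclidean metric, with standard covariant derivative $D$. A submanifold $M\subset\mathbb{R}^n$ is full if it is not contained in a hyperplane of $\mathbb{R}^n$. $M$ is a helix with respect to a unit vector $d\in\mathbb{R}^n$ if the angle $\theta$ between $d$ and $T_qM$ is the same for all $q\in M$; it is assumed that $0<\theta<\pi/2$. Then along $M$ one has $d=\cos(\theta)\,T+\sin(\theta)\,\xi$ with $T$ a unit tangent vector field of $M$ (the tangent direction) and $\xi$ a unit normal vector field of $M$ (the normal direction). The helix lines of $M$ with respect to $d$ are the integral curves of $T$; $M$ is a ruled helix if all its helix lines are (pieces of) straight lines of $\mathbb{R}^n$. For tangent fields $X,Y$ of $M$, $V(X,Y)$ denotes the normal component of $D_XY$ (second fundamental form); the normal curvature of a unit speed curve in $M$ with unit tangent $T$ is $\|V(T,T)\|$. *)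

theory Defs
  imports "HOL-Analysis.Analysis"
begin

section \<open>Smooth maps\<close>

text \<open>On finite-dimensional domains, and for open \<open>S\<close>, a map is \<open>C\<^sup>k\<^sup>+\<^sup>1\<close> iff it is differentiable
  on \<open>S\<close> and all of its directional derivatives are \<open>C\<^sup>k\<close> on \<open>S\<close>.\<close>

primrec Ck_on :: "nat \<Rightarrow> 'a::euclidean_space set \<Rightarrow> ('a \<Rightarrow> 'b::euclidean_space) \<Rightarrow> bool" where
  "Ck_on 0 S f \<longleftrightarrow> continuous_on S f"
| "Ck_on (Suc k) S f \<longleftrightarrow>
     (\<forall>x\<in>S. f differentiable (at x)) \<and> (\<forall>v. Ck_on k S (\<lambda>x. frechet_derivative f (at x) v))"

definition smooth_on :: "'a::euclidean_space set \<Rightarrow> ('a \<Rightarrow> 'b::euclidean_space) \<Rightarrow> bool" where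
  "smooth_on S f \<longleftrightarrow> (\<forall>k. Ck_on k S f)"


section \<open>Submanifolds of Euclidean space\<close>

text \<open>Embedded submanifolds without boundary: around each of its points, \<open>M\<close> is straightened by a
  diffeomorphism \<open>\<phi>\<close> (with inverse \<open>\<psi>\<close>) of open subsets of the ambient space onto an open piece of a
  \<open>k\<close>-dimensional linear subspace.\<close>

definition submanifold :: "nat \<Rightarrow> 'a::euclidean_space set \<Rightarrow> bool" where
  "submanifold k M \<longleftrightarrow>
     (\<forall>p\<in>M. \<exists>U V \<phi> \<psi> L.
        open U \<and> p \<in> U \<and> open (V :: 'a set) \<and>
        homeomorphism U V \<phi> \<psi> \<and> smooth_on U \<phi> \<and> smooth_on V \<psi> \<and>
        subspace L \<and> dim L = k \<and> \<phi> ` (M \<inter> U) = V \<inter> L)"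

definition full :: "'a::euclidean_space set \<Rightarrow> bool" where
  "full M \<longleftrightarrow> \<not> (\<exists>a b. a \<noteq> 0 \<and> M \<subseteq> {x. a \<bullet> x = b})"

definition tangent_space :: "'a::euclidean_space set \<Rightarrow> 'a \<Rightarrow> 'a set" where
  "tangent_space M q =
     {v. \<exists>\<gamma> \<epsilon>. 0 < \<epsilon> \<and> smooth_on {-\<epsilon><..<\<epsilon>} \<gamma> \<and> \<gamma> ` {-\<epsilon><..<\<epsilon>} \<subseteq> M \<and>
             \<gamma> (0::real) = q \<and> (\<gamma> has_vector_derivative v) (at 0)}"

definition normal_space :: "'a::euclidean_space set \<Rightarrow> 'a \<Rightarrow> 'a set" where
  "normal_space M q = orthogonal_comp (tangent_space M q)"

definition orth_proj :: "'a::euclidean_space set \<Rightarrow> 'a \<Rightarrow> 'a" where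
  "orth_proj W x = (THE y. y \<in> W \<and> x - y \<in> orthogonal_comp W)"

definition normal_component :: "'a::euclidean_space set \<Rightarrow> 'a \<Rightarrow> 'a \<Rightarrow> 'a" where
  "normal_component M q x = x - orth_proj (tangent_space M q) x"

text \<open>A field along \<open>M\<close> is only meaningful at points of \<open>M\<close>; it is smooth iff it locally extends to
  a smooth map on an open subset of the ambient space.\<close>

definition smooth_field :: "'a::euclidean_space set \<Rightarrow> ('a \<Rightarrow> 'a) \<Rightarrow> bool" where
  "smooth_field M Y \<longleftrightarrow>
     (\<forall>q\<in>M. \<exists>U Z. open U \<and> q \<in> U \<and> smooth_on U Z \<and> (\<forall>x\<in>M \<inter> U. Z x = Y x))"

definition tangent_field :: "'a::euclidean_space set \<Rightarrow> ('a \<Rightarrow> 'a) \<Rightarrow> bool" where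
  "tangent_field M Y \<longleftrightarrow> smooth_field M Y \<and> (\<forall>q\<in>M. Y q \<in> tangent_space M q)"

definition normal_field :: "'a::euclidean_space set \<Rightarrow> ('a \<Rightarrow> 'a) \<Rightarrow> bool" where
  "normal_field M Y \<longleftrightarrow> smooth_field M Y \<and> (\<forall>q\<in>M. Y q \<in> normal_space M q)"

text \<open>The standard covariant derivative \<open>D\<^sub>X Y\<close> for fields along \<open>M\<close>. A derivative within \<open>M\<close> is not
  unique as a linear map on the ambient space, but any two agree on \<open>tangent_space M q\<close>, so the value
  is well defined for smooth \<open>Y\<close> and tangent \<open>X\<close>; it is also the derivative, in direction \<open>X q\<close>, of
  any smooth extension of \<open>Y\<close>.\<close>

definition covariant_derivative ::
    "'a::euclidean_space set \<Rightarrow> ('a \<Rightarrow> 'a) \<Rightarrow> ('a \<Rightarrow> 'a) \<Rightarrow> 'a \<Rightarrow> 'a" where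
  "covariant_derivative M X Y q = frechet_derivative Y (at q within M) (X q)"

definition second_fundamental_form ::
    "'a::euclidean_space set \<Rightarrow> ('a \<Rightarrow> 'a) \<Rightarrow> ('a \<Rightarrow> 'a) \<Rightarrow> 'a \<Rightarrow> 'a" where
  "second_fundamental_form M X Y q = normal_component M q (covariant_derivative M X Y q)"


section \<open>Helix submanifolds\<close>

text \<open>Between nonzero vectors this is the usual angle in \<open>[0, \<pi>]\<close>. The convention for the zero vector
  makes the angle between \<open>d\<close> and a subspace equal to \<open>\<pi>/2\<close> when \<open>d\<close> is orthogonal to the subspace.\<close>

definition vector_angle :: "'a::euclidean_space \<Rightarrow> 'a \<Rightarrow> real" where
  "vector_angle u v =
     (if u = 0 \<or> v = 0 then pi / 2 else arccos (u \<bullet> v / (norm u * norm v)))"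

definition subspace_angle :: "'a::euclidean_space \<Rightarrow> 'a set \<Rightarrow> real" where
  "subspace_angle d W = vector_angle d (orth_proj W d)"

definition helix :: "'a::euclidean_space set \<Rightarrow> 'a \<Rightarrow> real \<Rightarrow> bool" where
  "helix M d \<theta> \<longleftrightarrow>
     norm d = 1 \<and> 0 < \<theta> \<and> \<theta> < pi / 2 \<and> (\<forall>q\<in>M. subspace_angle d (tangent_space M q) = \<theta>)"

text \<open>The decomposition \<open>d = cos \<theta> T + sin \<theta> \<xi>\<close> along \<open>M\<close>; it determines \<open>T\<close> and \<open>\<xi>\<close> at all
  points of \<open>M\<close>.\<close>

definition helix_directions ::
    "'a::euclidean_space set \<Rightarrow> 'a \<Rightarrow> real \<Rightarrow> ('a \<Rightarrow> 'a) \<Rightarrow> ('a \<Rightarrow> 'a) \<Rightarrow> bool" where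
  "helix_directions M d \<theta> T \<xi> \<longleftrightarrow>
     tangent_field M T \<and> normal_field M \<xi> \<and>
     (\<forall>q\<in>M. norm (T q) = 1 \<and> norm (\<xi> q) = 1 \<and> d = cos \<theta> *\<^sub>R T q + sin \<theta> *\<^sub>R \<xi> q)"

definition helix_line ::
    "'a::euclidean_space set \<Rightarrow> ('a \<Rightarrow> 'a) \<Rightarrow> real set \<Rightarrow> (real \<Rightarrow> 'a) \<Rightarrow> bool" where
  "helix_line M T J \<gamma> \<longleftrightarrow>
     open J \<and> is_interval J \<and> J \<noteq> {} \<and> smooth_on J \<gamma> \<and> \<gamma> ` J \<subseteq> M \<and>
     (\<forall>t\<in>J. (\<gamma> has_vector_derivative T (\<gamma> t)) (at t))"

text \<open>A piece of a straight line: for a curve, whose image is connected, it suffices that the image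
  lies in a line.\<close>

definition in_straight_line :: "'a::euclidean_space set \<Rightarrow> bool" where
  "in_straight_line C \<longleftrightarrow> (\<exists>L. affine L \<and> aff_dim L = 1 \<and> C \<subseteq> L)"

definition ruled_helix :: "'a::euclidean_space set \<Rightarrow> 'a \<Rightarrow> real \<Rightarrow> ('a \<Rightarrow> 'a) \<Rightarrow> bool" where
  "ruled_helix M d \<theta> T \<longleftrightarrow>
     helix M d \<theta> \<and> (\<forall>J \<gamma>. helix_line M T J \<gamma> \<longrightarrow> in_straight_line (\<gamma> ` J))"

text \<open>Normal curvature at parameter \<open>t\<close> of a unit speed curve \<open>\<gamma>\<close> in \<open>M\<close> whose unit tangent is the
  restriction to \<open>\<gamma>\<close> of the tangent field \<open>T\<close> of \<open>M\<close>.\<close>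

definition normal_curvature ::
    "'a::euclidean_space set \<Rightarrow> ('a \<Rightarrow> 'a) \<Rightarrow> (real \<Rightarrow> 'a) \<Rightarrow> real \<Rightarrow> real" where
  "normal_curvature M T \<gamma> t = norm (second_fundamental_form M T T (\<gamma> t))"

end

theory Submission
  imports Defs
begin

text \<open>The acceleration of a helix line \<open>\<gamma>\<close> is \<open>D\<^sub>T T\<close> along \<open>\<gamma>\<close>, because \<open>\<gamma>' = T \<circ> \<gamma>\<close>. The point of
  the proof is that \<open>D\<^sub>T T\<close> has no tangential part, so that it coincides with \<open>V(T, T)\<close>; in other
  words, helix lines are geodesics of \<open>M\<close>. Then \<open>\<gamma>\<close> has zero normal curvature iff \<open>\<gamma>'' = 0\<close>, and for
  a unit speed curve this means that \<open>\<gamma>\<close> runs on a straight line: a curve on a line has its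
  acceleration parallel to its velocity, whereas constant speed makes the two orthogonal.

  Helix lines are geodesics because the height function \<open>h(x) = (d \<bullet> x) / cos \<theta>\<close> on \<open>M\<close> has gradient
  \<open>T\<close>, which has constant length. Since the Hessian of \<open>h\<close> is symmetric
  (lemma \<open>gradient_derivative_symmetric\<close>), \<open>D\<^sub>T T \<bullet> X = D\<^sub>X T \<bullet> T\<close> for tangent \<open>X\<close>, and the right-hand
  side is half the derivative of \<open>T \<bullet> T = 1\<close> in direction \<open>X\<close>
  (lemma \<open>unit_field_derivative_orthogonal\<close>).

  The symmetry of the Hessian is proved in a chart \<open>\<psi>\<close>: it reduces to \<open>\<partial>\<^sub>b \<partial>\<^sub>a \<psi> = \<partial>\<^sub>a \<partial>\<^sub>b \<psi>\<close>, which in turn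
  comes from the mean value theorem applied to second differences
  (lemma \<open>mixed_derivatives_commute\<close>).\<close>

section \<open>Symmetry of mixed derivatives\<close>

lemma derivative_along_line_shift:
  fixes f :: "'a::real_normed_vector \<Rightarrow> real"
  assumes "((\<lambda>t. f ((x + s *\<^sub>R a) + t *\<^sub>R a)) has_real_derivative D) (at 0)"
  shows "((\<lambda>t. f (x + t *\<^sub>R a)) has_real_derivative D) (at s)"
proof -
  have "((\<lambda>t. f (x + (t + s) *\<^sub>R a)) has_real_derivative D) (at 0)"
    using assms by (simp add: algebra_simps)
  then show ?thesis
    using DERIV_shift[of "\<lambda>t. f (x + t *\<^sub>R a)" D 0 s] by simp
qed

text \<open>The second difference over a parallelogram is symmetric in its two sides \<open>h a\<close> and \<open>h b\<close>. Two
  applications of the mean value theorem, first along \<open>a\<close> and then along \<open>b\<close>, express it through the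
  mixed derivative taken in this order.\<close>

lemma second_difference_mean_value:
  fixes f fa fab :: "'a::real_normed_vector \<Rightarrow> real"
  assumes fa: "\<And>x. x \<in> S \<Longrightarrow> ((\<lambda>t. f (x + t *\<^sub>R a)) has_real_derivative fa x) (at 0)"
    and fab: "\<And>x. x \<in> S \<Longrightarrow> ((\<lambda>t. fa (x + t *\<^sub>R b)) has_real_derivative fab x) (at 0)"
    and "0 < h"
    and S: "\<And>s t. \<lbrakk>0 \<le> s; s \<le> h; 0 \<le> t; t \<le> h\<rbrakk> \<Longrightarrow> u + s *\<^sub>R a + t *\<^sub>R b \<in> S"
  shows "\<exists>s t. 0 < s \<and> s < h \<and> 0 < t \<and> t < h \<and>
    f (u + h *\<^sub>R a + h *\<^sub>R b) - f (u + h *\<^sub>R a) - f (u + h *\<^sub>R b) + f u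
      = h * h * fab (u + s *\<^sub>R a + t *\<^sub>R b)"
proof -
  define g where "g s = f ((u + h *\<^sub>R b) + s *\<^sub>R a) - f (u + s *\<^sub>R a)" for s
  define g' where "g' s = fa (u + s *\<^sub>R a + h *\<^sub>R b) - fa (u + s *\<^sub>R a)" for s
  have "(g has_real_derivative g' s) (at s)" if "0 \<le> s" "s \<le> h" for s
  proof -
    have "(u + h *\<^sub>R b) + s *\<^sub>R a \<in> S" "u + s *\<^sub>R a \<in> S"
      using S[of s h] S[of s 0] that \<open>0 < h\<close> by (simp_all add: add_ac)
    from DERIV_diff[OF this[THEN fa, THEN derivative_along_line_shift]] show ?thesis
      unfolding g_def g'_def by (simp only: add_ac)
  qed
  from MVT2[of 0 h g g', OF \<open>0 < h\<close> this] obtain s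
    where s: "0 < s" "s < h" "g h - g 0 = h * g' s" by auto
  have "((\<lambda>t. fa ((u + s *\<^sub>R a) + t *\<^sub>R b)) has_real_derivative fab (u + s *\<^sub>R a + t *\<^sub>R b)) (at t)"
    if "0 \<le> t" "t \<le> h" for t
    using fab[OF S, of s t] s that by (auto intro: derivative_along_line_shift)
  from MVT2[of 0 h "\<lambda>t. fa ((u + s *\<^sub>R a) + t *\<^sub>R b)", OF \<open>0 < h\<close> this] obtain t
    where t: "0 < t" "t < h" "g' s = h * fab (u + s *\<^sub>R a + t *\<^sub>R b)"
    by (auto simp: g'_def)
  have "f (u + h *\<^sub>R a + h *\<^sub>R b) - f (u + h *\<^sub>R a) - f (u + h *\<^sub>R b) + f u = g h - g 0"
    by (simp add: g_def add_ac)
  also have "\<dots> = h * h * fab (u + s *\<^sub>R a + t *\<^sub>R b)"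
    using s t by simp
  finally show ?thesis using s t by blast
qed

text \<open>Evaluating the symmetric second difference in both orders gives two points of a small
  parallelogram at \<open>u\<close> where the two mixed derivatives agree; continuity carries this over to \<open>u\<close>.\<close>

lemma mixed_derivatives_commute:
  fixes f fa fb fab fba :: "'a::real_normed_vector \<Rightarrow> real"
  assumes "open S" "u \<in> S"
    and fa: "\<And>x. x \<in> S \<Longrightarrow> ((\<lambda>t. f (x + t *\<^sub>R a)) has_real_derivative fa x) (at 0)"
    and fb: "\<And>x. x \<in> S \<Longrightarrow> ((\<lambda>t. f (x + t *\<^sub>R b)) has_real_derivative fb x) (at 0)"
    and fab: "\<And>x. x \<in> S \<Longrightarrow> ((\<lambda>t. fa (x + t *\<^sub>R b)) has_real_derivative fab x) (at 0)"
    and fba: "\<And>x. x \<in> S \<Longrightarrow> ((\<lambda>t. fb (x + t *\<^sub>R a)) has_real_derivative fba x) (at 0)"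
    and "continuous_on S fab" "continuous_on S fba"
  shows "fab u = fba u"
proof (rule ccontr)
  assume "fab u \<noteq> fba u"
  define e where "e = dist (fab u) (fba u) / 2"
  have "e > 0" using \<open>fab u \<noteq> fba u\<close> by (simp add: e_def)
  have "isCont fab u" "isCont fba u"
    using assms by (auto simp: continuous_on_eq_continuous_at)
  with \<open>e > 0\<close> obtain r1 r2 where r1: "r1 > 0" "\<And>x. dist x u < r1 \<Longrightarrow> dist (fab x) (fab u) < e"
    and r2: "r2 > 0" "\<And>x. dist x u < r2 \<Longrightarrow> dist (fba x) (fba u) < e"
    unfolding continuous_at_eps_delta dist_norm by metis
  from \<open>open S\<close> \<open>u \<in> S\<close> obtain r3 where r3: "r3 > 0" "\<And>x. dist x u < r3 \<Longrightarrow> x \<in> S"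
    unfolding open_dist by blast
  define r where "r = min r1 (min r2 r3)"
  have "r > 0" using r1 r2 r3 by (simp add: r_def)
  (* small enough for the whole parallelogram with sides h a and h b at u to lie in the r-ball *)
  define h where "h = r / (norm a + norm b + 1)"
  have "h > 0" unfolding h_def using \<open>r > 0\<close>
    by (intro divide_pos_pos add_nonneg_pos) auto
  have near: "dist (u + s *\<^sub>R a + t *\<^sub>R b) u < r" if "0 \<le> s" "s \<le> h" "0 \<le> t" "t \<le> h" for s t
  proof -
    have "dist (u + s *\<^sub>R a + t *\<^sub>R b) u \<le> norm (s *\<^sub>R a) + norm (t *\<^sub>R b)"
      using norm_triangle_ineq[of "s *\<^sub>R a" "t *\<^sub>R b"] by (simp add: dist_norm add.assoc)
    also have "\<dots> \<le> h * norm a + h * norm b"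
      using that by (intro add_mono) (auto intro: mult_right_mono)
    also have "\<dots> < h * (norm a + norm b + 1)"
      using \<open>h > 0\<close> by (simp add: algebra_simps)
    also have "\<dots> = r"
    proof -
      have "norm a + norm b + 1 > 0" by (intro add_nonneg_pos) auto
      then show ?thesis by (simp add: h_def)
    qed
    finally show ?thesis .
  qed
  have inS: "u + s *\<^sub>R a + t *\<^sub>R b \<in> S" if "0 \<le> s" "s \<le> h" "0 \<le> t" "t \<le> h" for s t
    using near[OF that] r3 by (simp add: r_def)
  obtain s t where st: "0 < s" "s < h" "0 < t" "t < h"
    "f (u + h *\<^sub>R a + h *\<^sub>R b) - f (u + h *\<^sub>R a) - f (u + h *\<^sub>R b) + f u
      = h * h * fab (u + s *\<^sub>R a + t *\<^sub>R b)"
    using second_difference_mean_value[where S=S, OF fa fab \<open>h > 0\<close> inS] by blast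
  have inS': "u + t *\<^sub>R b + s *\<^sub>R a \<in> S" if "0 \<le> t" "t \<le> h" "0 \<le> s" "s \<le> h" for s t
    using inS[OF that(3,4,1,2)] by (simp add: add_ac)
  obtain t' s' where st': "0 < t'" "t' < h" "0 < s'" "s' < h"
    "f (u + h *\<^sub>R b + h *\<^sub>R a) - f (u + h *\<^sub>R b) - f (u + h *\<^sub>R a) + f u
      = h * h * fba (u + t' *\<^sub>R b + s' *\<^sub>R a)"
    using second_difference_mean_value[where S=S, OF fb fba \<open>h > 0\<close> inS'] by blast
  have swap: "u + t *\<^sub>R b + s *\<^sub>R a = u + s *\<^sub>R a + t *\<^sub>R b" for s t
    by (simp add: add_ac)
  have "h * h * fab (u + s *\<^sub>R a + t *\<^sub>R b) = h * h * fba (u + s' *\<^sub>R a + t' *\<^sub>R b)"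
    using st(5) st'(5) unfolding swap by linarith
  then have eq: "fba (u + s' *\<^sub>R a + t' *\<^sub>R b) = fab (u + s *\<^sub>R a + t *\<^sub>R b)"
    using \<open>h > 0\<close> by simp
  have "dist (fab (u + s *\<^sub>R a + t *\<^sub>R b)) (fab u) < e"
    using near[of s t] st r1 by (simp add: r_def)
  moreover have "dist (fab (u + s *\<^sub>R a + t *\<^sub>R b)) (fba u) < e"
    unfolding eq[symmetric] using near[of s' t'] st' r2 by (simp add: r_def)
  ultimately have "dist (fab u) (fba u) < dist (fab u) (fba u)"
    unfolding e_def by (rule dist_triangle_half_r)
  then show False by simp
qed


section \<open>Smooth maps\<close>

lemma smooth_on_imp_differentiable:
  assumes "smooth_on S f" "x \<in> S"
  shows "f differentiable (at x)"
proof -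
  have "Ck_on (Suc 0) S f" using assms(1) unfolding smooth_on_def by blast
  then show ?thesis using assms(2) by simp
qed

lemma smooth_on_directional_derivative:
  assumes "smooth_on S f"
  shows "smooth_on S (\<lambda>x. frechet_derivative f (at x) v)"
  unfolding smooth_on_def
proof
  fix k
  have "Ck_on (Suc k) S f" using assms unfolding smooth_on_def by blast
  then show "Ck_on k S (\<lambda>x. frechet_derivative f (at x) v)" by simp
qed

lemma smooth_on_imp_continuous_on:
  assumes "smooth_on S f"
  shows "continuous_on S f"
proof -
  have "Ck_on 0 S f" using assms unfolding smooth_on_def by blast
  then show ?thesis by simp
qed

lemma smooth_on_has_derivative:
  assumes "smooth_on S f" "x \<in> S"
  shows "(f has_derivative frechet_derivative f (at x)) (at x)"
  using smooth_on_imp_differentiable[OF assms] frechet_derivative_works by blast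

lemma smooth_on_line_derivative:
  assumes "smooth_on S f" "u + s *\<^sub>R a \<in> S"
  shows "((\<lambda>t. f (u + t *\<^sub>R a)) has_vector_derivative frechet_derivative f (at (u + s *\<^sub>R a)) a) (at s)"
proof -
  have "((\<lambda>t. u + t *\<^sub>R a) has_vector_derivative a) (at s)"
    by (auto intro!: derivative_eq_intros)
  from vector_derivative_diff_chain_within[OF this, of f] show ?thesis
    using smooth_on_has_derivative[OF assms]
    by (auto simp: o_def intro: has_derivative_at_withinI)
qed

text \<open>Openness lets the equality on \<open>S\<close> pass to the derivatives, which are taken in the whole
  space.\<close>

lemma Ck_on_cong:
  assumes "Ck_on k S f" "open S" "\<And>x. x \<in> S \<Longrightarrow> f x = g x"
  shows "Ck_on k S g"
  using assms(1,3)
proof (induction k arbitrary: f g)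
  case 0
  then show ?case by (simp cong: continuous_on_cong)
next
  case (Suc k)
  have d: "(g has_derivative frechet_derivative f (at x)) (at x)" if "x \<in> S" for x
  proof -
    have "(f has_derivative frechet_derivative f (at x)) (at x)"
      using Suc.prems(1) that frechet_derivative_works by auto
    then show ?thesis
      by (rule has_derivative_transform_within_open[OF _ \<open>open S\<close> that]) (simp add: Suc.prems)
  qed
  have "Ck_on k S (\<lambda>x. frechet_derivative g (at x) v)" for v
  proof (rule Suc.IH)
    show "Ck_on k S (\<lambda>x. frechet_derivative f (at x) v)" using Suc.prems(1) by simp
    show "frechet_derivative f (at x) v = frechet_derivative g (at x) v" if "x \<in> S" for x
      using frechet_derivative_at[OF d[OF that]] by simp
  qed
  then show ?case using d by (auto simp: differentiable_def)
qed

lemma Ck_on_subset: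
  assumes "Ck_on k S f" "S' \<subseteq> S"
  shows "Ck_on k S' f"
  using assms by (induction k arbitrary: f) (auto intro: continuous_on_subset)

lemma open_line_preimage:
  fixes u a :: "'a::real_normed_vector"
  assumes "open S"
  shows "open {t. u + t *\<^sub>R a \<in> S}"
proof -
  have "continuous_on UNIV (\<lambda>t. u + t *\<^sub>R a)" by (intro continuous_intros)
  from open_vimage[OF assms this] show ?thesis by (simp add: vimage_def)
qed

text \<open>The derivative along the line is again the restriction to the line of a directional derivative
  of \<open>f\<close>, so the induction needs no chain rule for \<open>C\<^sup>k\<close> maps.\<close>

lemma Ck_on_along_line:
  fixes f :: "'a::euclidean_space \<Rightarrow> 'b::euclidean_space"
  assumes "Ck_on k S f" "open S"
  shows "Ck_on k {t::real. u + t *\<^sub>R a \<in> S} (\<lambda>t. f (u + t *\<^sub>R a))"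
  using assms(1)
proof (induction k arbitrary: f)
  case 0
  then show ?case
    by (auto intro!: continuous_on_compose2[of S f] continuous_intros)
next
  case (Suc k)
  let ?I = "{t. u + t *\<^sub>R a \<in> S}"
  have "open ?I" by (rule open_line_preimage[OF \<open>open S\<close>])
  have d: "((\<lambda>t. f (u + t *\<^sub>R a)) has_derivative
      (\<lambda>r. frechet_derivative f (at (u + t *\<^sub>R a)) (r *\<^sub>R a))) (at t)" if "t \<in> ?I" for t
  proof -
    have "(f has_derivative frechet_derivative f (at (u + t *\<^sub>R a))) (at (u + t *\<^sub>R a))"
      using Suc.prems(1) that frechet_derivative_works by auto
    moreover have "((\<lambda>t. u + t *\<^sub>R a) has_derivative (\<lambda>r. r *\<^sub>R a)) (at t)"
      by (auto intro!: derivative_eq_intros)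
    ultimately show ?thesis
      using diff_chain_at[of "\<lambda>t. u + t *\<^sub>R a" "\<lambda>r. r *\<^sub>R a" t f] by (simp add: o_def)
  qed
  have "Ck_on k ?I (\<lambda>t. frechet_derivative (\<lambda>t. f (u + t *\<^sub>R a)) (at t) r)" for r
  proof (rule Ck_on_cong[OF _ \<open>open ?I\<close>])
    show "Ck_on k ?I (\<lambda>t. frechet_derivative f (at (u + t *\<^sub>R a)) (r *\<^sub>R a))"
      using Suc.IH[of "\<lambda>x. frechet_derivative f (at x) (r *\<^sub>R a)"] Suc.prems by simp
    show "frechet_derivative f (at (u + t *\<^sub>R a)) (r *\<^sub>R a)
        = frechet_derivative (\<lambda>t. f (u + t *\<^sub>R a)) (at t) r" if "t \<in> ?I" for t
      using fun_cong[OF frechet_derivative_at[OF d[OF that]], of r] by simp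
  qed
  then show ?case using d by (auto simp: differentiable_def)
qed

text \<open>The scalar case applies to \<open>w \<bullet> f\<close> for every vector \<open>w\<close>.\<close>

lemma smooth_on_mixed_derivatives_commute:
  fixes f :: "'a::euclidean_space \<Rightarrow> 'b::euclidean_space"
  assumes f: "smooth_on S f" and "open S" "u \<in> S"
  shows "frechet_derivative (\<lambda>x. frechet_derivative f (at x) a) (at u) b
       = frechet_derivative (\<lambda>x. frechet_derivative f (at x) b) (at u) a"
proof (rule vector_eq_rdot[THEN iffD1], rule allI)
  fix w
  note D = smooth_on_directional_derivative
  have d: "((\<lambda>t. w \<bullet> g (x + t *\<^sub>R v)) has_real_derivative w \<bullet> frechet_derivative g (at x) v) (at 0)"
    if "smooth_on S g" "x \<in> S" for g :: "'a \<Rightarrow> 'b" and x v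
    using has_derivative_inner_right[OF smooth_on_line_derivative[OF that(1), of x 0 v, unfolded has_vector_derivative_def], of w]
      that(2) by (simp add: has_field_derivative_def mult.commute[of _ "w \<bullet> _"])
  have "w \<bullet> frechet_derivative (\<lambda>x. frechet_derivative f (at x) a) (at u) b
       = w \<bullet> frechet_derivative (\<lambda>x. frechet_derivative f (at x) b) (at u) a"
    by (rule mixed_derivatives_commute[where f="\<lambda>x. w \<bullet> f x" and S=S and a=a and b=b
          and fa="\<lambda>x. w \<bullet> frechet_derivative f (at x) a" and fb="\<lambda>x. w \<bullet> frechet_derivative f (at x) b"
          and fab="\<lambda>x. w \<bullet> frechet_derivative (\<lambda>x. frechet_derivative f (at x) a) (at x) b"
          and fba="\<lambda>x. w \<bullet> frechet_derivative (\<lambda>x. frechet_derivative f (at x) b) (at x) a"])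
      (use assms in \<open>auto intro!: d D continuous_on_inner continuous_on_const
          smooth_on_imp_continuous_on[OF D[OF D]]\<close>)
  then show "frechet_derivative (\<lambda>x. frechet_derivative f (at x) a) (at u) b \<bullet> w
       = frechet_derivative (\<lambda>x. frechet_derivative f (at x) b) (at u) a \<bullet> w"
    by (simp add: inner_commute)
qed


section \<open>Tangent spaces in a chart\<close>

text \<open>The data of one chart in the definition of a submanifold, kept together because the tangent
  space is described relative to them.\<close>

definition straightening ::
    "'a::euclidean_space set \<Rightarrow> 'a set \<Rightarrow> 'a set \<Rightarrow> ('a \<Rightarrow> 'a) \<Rightarrow> ('a \<Rightarrow> 'a) \<Rightarrow> 'a set \<Rightarrow> bool" where
  "straightening M U V \<phi> \<psi> L \<longleftrightarrow> open U \<and> open V \<and> homeomorphism U V \<phi> \<psi> \<and>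
     smooth_on U \<phi> \<and> smooth_on V \<psi> \<and> subspace L \<and> \<phi> ` (M \<inter> U) = V \<inter> L"

lemma straightening_inverse_in:
  assumes "straightening M U V \<phi> \<psi> L" "x \<in> V \<inter> L"
  shows "\<psi> x \<in> M"
proof -
  obtain p where "p \<in> M \<inter> U" "x = \<phi> p"
    using assms unfolding straightening_def by blast
  then show ?thesis using assms(1) by (simp add: straightening_def homeomorphism_def)
qed

lemma subspace_line_in:
  assumes "subspace L" "u \<in> L" "a \<in> L"
  shows "u + t *\<^sub>R a \<in> L"
  using assms by (simp add: subspace_add subspace_scale)

lemma open_line_interval:
  fixes u a :: "'a::real_normed_vector"
  assumes "open V" "u \<in> V"
  obtains \<epsilon> where "0 < \<epsilon>" "\<And>t. t \<in> {-\<epsilon><..<\<epsilon>} \<Longrightarrow> u + t *\<^sub>R a \<in> V"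
proof -
  have "open {t. u + t *\<^sub>R a \<in> V}" by (rule open_line_preimage[OF \<open>open V\<close>])
  moreover have "0 \<in> {t. u + t *\<^sub>R a \<in> V}" using assms by simp
  ultimately obtain \<epsilon> where "\<epsilon> > 0" "\<And>t. dist t 0 < \<epsilon> \<Longrightarrow> t \<in> {t. u + t *\<^sub>R a \<in> V}"
    unfolding open_dist by blast
  then show ?thesis by (intro that[of \<epsilon>]) (auto simp: dist_real_def)
qed

text \<open>Together with \<open>tangent_space_subset_chart_derivative\<close> this identifies \<open>T\<^sub>q M\<close> with the image of
  \<open>L\<close> under the derivative of \<open>\<psi>\<close>. Here the curve is the image of the straight line through \<open>u\<close> in
  direction \<open>a\<close>.\<close>

lemma chart_derivative_in_tangent_space:
  assumes S: "straightening M U V \<phi> \<psi> L" and u: "u \<in> V \<inter> L" and "a \<in> L"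
  shows "frechet_derivative \<psi> (at u) a \<in> tangent_space M (\<psi> u)"
proof -
  from S have "open V" and smooth: "smooth_on V \<psi>" and "subspace L"
    by (auto simp: straightening_def)
  from \<open>open V\<close> u obtain \<epsilon> where \<epsilon>: "0 < \<epsilon>" "\<And>t. t \<in> {-\<epsilon><..<\<epsilon>} \<Longrightarrow> u + t *\<^sub>R a \<in> V"
    by (metis IntD1 open_line_interval)
  let ?c = "\<lambda>t. \<psi> (u + t *\<^sub>R a)"
  have "smooth_on {-\<epsilon><..<\<epsilon>} ?c"
    unfolding smooth_on_def
  proof
    fix k
    have "Ck_on k {t. u + t *\<^sub>R a \<in> V} ?c"
      using smooth \<open>open V\<close> by (intro Ck_on_along_line) (auto simp: smooth_on_def)
    then show "Ck_on k {-\<epsilon><..<\<epsilon>} ?c" using \<epsilon> by (auto intro: Ck_on_subset)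
  qed
  moreover have "?c ` {-\<epsilon><..<\<epsilon>} \<subseteq> M"
    using \<epsilon> straightening_inverse_in[OF S] subspace_line_in[OF \<open>subspace L\<close>] u \<open>a \<in> L\<close> by auto
  moreover have "(?c has_vector_derivative frechet_derivative \<psi> (at u) a) (at 0)"
    using smooth_on_line_derivative[OF smooth, of u 0 a] u by simp
  ultimately show ?thesis
    unfolding tangent_space_def using \<open>0 < \<epsilon>\<close> by fastforce
qed

text \<open>Every vector orthogonal to \<open>L\<close> annihilates the curve, hence also its velocity.\<close>

lemma derivative_in_subspace:
  fixes c :: "real \<Rightarrow> 'a::euclidean_space"
  assumes "subspace L" "open I" "t \<in> I" "\<And>s. s \<in> I \<Longrightarrow> c s \<in> L"
    and c: "(c has_vector_derivative a) (at t)"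
  shows "a \<in> L"
proof -
  have "a \<bullet> w = 0" if "w \<in> orthogonal_comp L" for w
  proof -
    have "((\<lambda>s. c s \<bullet> w) has_vector_derivative a \<bullet> w) (at t)"
      using c unfolding has_vector_derivative_def by (auto intro!: derivative_eq_intros)
    moreover have "((\<lambda>s. c s \<bullet> w) has_vector_derivative 0) (at t)"
    proof (rule has_vector_derivative_transform_within_open[OF _ \<open>open I\<close> \<open>t \<in> I\<close>])
      show "((\<lambda>s. 0::real) has_vector_derivative 0) (at t)" by simp
      show "0 = c s \<bullet> w" if "s \<in> I" for s
        using assms(4)[OF that] \<open>w \<in> orthogonal_comp L\<close>
        by (simp add: orthogonal_comp_def orthogonal_def)
    qed
    ultimately show ?thesis by (rule vector_derivative_unique_at)
  qed
  then have "a \<in> orthogonal_comp (orthogonal_comp L)"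
    by (simp add: orthogonal_comp_def orthogonal_def inner_commute)
  then show ?thesis using \<open>subspace L\<close> by (simp add: orthogonal_comp_self)
qed

text \<open>A curve in \<open>M\<close> through \<open>q\<close> is mapped by \<open>\<phi>\<close> to a curve in \<open>L\<close>. The velocity \<open>a\<close> of the latter
  lies in \<open>L\<close>, and going back with \<open>\<psi>\<close> recovers the velocity of the former.\<close>

lemma tangent_space_subset_chart_derivative:
  assumes S: "straightening M U V \<phi> \<psi> L" and q: "q \<in> U" and X: "X \<in> tangent_space M q"
  obtains a where "a \<in> L" "frechet_derivative \<psi> (at (\<phi> q)) a = X"
proof -
  from S have "open U" and smooth: "smooth_on V \<psi>" "smooth_on U \<phi>" and "subspace L"
    and hom: "homeomorphism U V \<phi> \<psi>" and img: "\<phi> ` (M \<inter> U) = V \<inter> L"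
    by (auto simp: straightening_def)
  from X obtain \<gamma> \<epsilon> where \<gamma>: "0 < \<epsilon>" "smooth_on {-\<epsilon><..<\<epsilon>} \<gamma>" "\<gamma> ` {-\<epsilon><..<\<epsilon>} \<subseteq> M"
      "\<gamma> 0 = q" "(\<gamma> has_vector_derivative X) (at 0)"
    unfolding tangent_space_def by blast
  have "continuous_on {-\<epsilon><..<\<epsilon>} \<gamma>" by (rule smooth_on_imp_continuous_on) fact
  then have open_I: "open ({-\<epsilon><..<\<epsilon>} \<inter> \<gamma> -` U)" (is "open ?I")
    using \<open>open U\<close> by (auto intro: continuous_open_preimage)
  have "0 \<in> ?I" using \<gamma> q by simp
  define a where "a = frechet_derivative \<phi> (at q) X"
  have da: "((\<lambda>t. \<phi> (\<gamma> t)) has_vector_derivative a) (at 0)"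
    using vector_derivative_diff_chain_within[OF \<gamma>(5), of \<phi>] smooth_on_has_derivative[OF smooth(2) q]
    by (auto simp: o_def a_def \<gamma>(4) intro: has_derivative_at_withinI)
  have "\<phi> (\<gamma> t) \<in> L" if "t \<in> ?I" for t
    using that \<gamma>(3) img by blast
  then have "a \<in> L" using derivative_in_subspace[OF \<open>subspace L\<close> open_I \<open>0 \<in> ?I\<close> _ da] by blast
  have "\<phi> q \<in> V" using hom q by (auto simp: homeomorphism_def)
  have "((\<lambda>t. \<psi> (\<phi> (\<gamma> t))) has_vector_derivative frechet_derivative \<psi> (at (\<phi> q)) a) (at 0)"
    using vector_derivative_diff_chain_within[OF da, of \<psi>]
      smooth_on_has_derivative[OF smooth(1) \<open>\<phi> q \<in> V\<close>]
    by (auto simp: o_def \<gamma>(4) intro: has_derivative_at_withinI)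
  then have "(\<gamma> has_vector_derivative frechet_derivative \<psi> (at (\<phi> q)) a) (at 0)"
    by (rule has_vector_derivative_transform_within_open[OF _ open_I \<open>0 \<in> ?I\<close>])
      (use hom in \<open>auto simp: homeomorphism_def\<close>)
  then have "frechet_derivative \<psi> (at (\<phi> q)) a = X"
    using \<gamma>(5) vector_derivative_unique_at by blast
  with \<open>a \<in> L\<close> that show thesis by blast
qed


section \<open>Derivatives of fields along a submanifold\<close>

text \<open>A derivative within \<open>M\<close> is not unique as a linear map; this lemma shows that its values on
  velocities of curves in \<open>M\<close> are nevertheless derivatives along these curves, which is all that is
  used of the covariant derivative.\<close>

lemma derivative_along_curve_in:
  assumes Y: "(Y has_derivative A) (at (c t) within M)"
    and c: "(c has_vector_derivative v) (at t)"
    and "open I" "t \<in> I" "\<And>s. s \<in> I \<Longrightarrow> c s \<in> M"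
  shows "((\<lambda>s. Y (c s)) has_vector_derivative A v) (at t)"
proof -
  have "(Y has_derivative A) (at (c t) within c ` I)"
    using Y assms by (auto intro: has_derivative_subset)
  from vector_derivative_diff_chain_within[OF has_vector_derivative_at_within[OF c] this]
  show ?thesis
    unfolding has_vector_derivative_within_open[OF \<open>t \<in> I\<close> \<open>open I\<close>] o_def .
qed

lemma smooth_field_has_derivative:
  assumes "smooth_field M Y" "q \<in> M"
  shows "(Y has_derivative frechet_derivative Y (at q within M)) (at q within M)"
proof -
  obtain U Z where U: "open U" "q \<in> U" "smooth_on U Z" "\<forall>x\<in>M \<inter> U. Z x = Y x"
    using assms unfolding smooth_field_def by blast
  from smooth_on_has_derivative[OF U(3,2)]
  have Z: "(Z has_derivative frechet_derivative Z (at q)) (at q within M)"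
    by (rule has_derivative_at_withinI)
  obtain e where e: "e > 0" "\<And>x. dist x q < e \<Longrightarrow> x \<in> U"
    using U(1,2) unfolding open_dist by blast
  have "(Y has_derivative frechet_derivative Z (at q)) (at q within M)"
    by (rule has_derivative_transform_within[OF Z \<open>e > 0\<close> \<open>q \<in> M\<close>]) (use e U in \<open>auto\<close>)
  then show ?thesis using frechet_derivative_works differentiable_def by blast
qed

text \<open>The hypothesis \<open>grad\<close> says that the tangential part of \<open>Y\<close> is the gradient on \<open>M\<close> of the linear
  function \<open>x \<mapsto> c \<bullet> x\<close>, and the conclusion is the symmetry of the Hessian of that function. In a
  chart, \<open>c - Y\<close> is orthogonal to the tangent vector \<open>\<partial>\<^sub>a \<psi>\<close>; differentiating this in direction \<open>b\<close>
  turns \<open>A (\<partial>\<^sub>b \<psi>) \<bullet> \<partial>\<^sub>a \<psi>\<close> into \<open>(c - Y) \<bullet> \<partial>\<^sub>b \<partial>\<^sub>a \<psi>\<close>, which is symmetric in \<open>a\<close> and \<open>b\<close>.\<close>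

lemma gradient_derivative_symmetric:
  assumes "submanifold k M" and "q \<in> M"
    and A: "(Y has_derivative A) (at q within M)"
    and grad: "\<And>p X. \<lbrakk>p \<in> M; X \<in> tangent_space M p\<rbrakk> \<Longrightarrow> Y p \<bullet> X = c \<bullet> X"
    and tan: "X \<in> tangent_space M q" "X' \<in> tangent_space M q"
  shows "A X \<bullet> X' = A X' \<bullet> X"
proof -
  obtain U V \<phi> \<psi> L where S: "straightening M U V \<phi> \<psi> L" and "q \<in> U"
    using assms(1,2) unfolding submanifold_def straightening_def by meson
  then have "open V" and smooth: "smooth_on V \<psi>" and "subspace L"
    and hom: "homeomorphism U V \<phi> \<psi>" and img: "\<phi> ` (M \<inter> U) = V \<inter> L"
    by (auto simp: straightening_def)
  define u where "u = \<phi> q"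
  have u: "u \<in> V" "u \<in> L" "\<psi> u = q"
    using img hom \<open>q \<in> M\<close> \<open>q \<in> U\<close> by (auto simp: u_def homeomorphism_def)
  let ?D = "\<lambda>a x. frechet_derivative \<psi> (at x) a"
  have smooth_D: "smooth_on V (?D a)" for a
    by (rule smooth_on_directional_derivative[OF smooth])
  have eq: "A (?D b u) \<bullet> ?D a u = (c - Y q) \<bullet> frechet_derivative (?D a) (at u) b"
    if "a \<in> L" "b \<in> L" for a b
  proof -
    obtain \<epsilon> where \<epsilon>: "0 < \<epsilon>" "\<And>t. t \<in> {-\<epsilon><..<\<epsilon>} \<Longrightarrow> u + t *\<^sub>R b \<in> V"
      using open_line_interval[OF \<open>open V\<close> u(1)] by metis
    have VL: "u + t *\<^sub>R b \<in> V \<inter> L" if "t \<in> {-\<epsilon><..<\<epsilon>}" for t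
      using \<epsilon>(2)[OF that] subspace_line_in[OF \<open>subspace L\<close> u(2) \<open>b \<in> L\<close>] by simp
    have "((\<lambda>t. \<psi> (u + t *\<^sub>R b)) has_vector_derivative ?D b u) (at 0)"
      using smooth_on_line_derivative[OF smooth, of u 0 b] u by simp
    then have dY: "((\<lambda>t. Y (\<psi> (u + t *\<^sub>R b))) has_vector_derivative A (?D b u)) (at 0)"
      by (rule derivative_along_curve_in[where I="{-\<epsilon><..<\<epsilon>}" and M=M, rotated])
        (use A u(3) \<epsilon>(1) VL straightening_inverse_in[OF S] in simp_all)
    have dD: "((\<lambda>t. ?D a (u + t *\<^sub>R b)) has_vector_derivative frechet_derivative (?D a) (at u) b) (at 0)"
      using smooth_on_line_derivative[OF smooth_D, of u 0 b a] u by simp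
    (* ?f vanishes since Y is the gradient; its derivative at 0 is the asserted identity *)
    let ?f = "\<lambda>t. (c - Y (\<psi> (u + t *\<^sub>R b))) \<bullet> ?D a (u + t *\<^sub>R b)"
    have "(?f has_vector_derivative
        (c - Y q) \<bullet> frechet_derivative (?D a) (at u) b - A (?D b u) \<bullet> ?D a u) (at 0)"
      using dY dD unfolding has_vector_derivative_def
      by (auto intro!: derivative_eq_intros simp: u algebra_simps)
    moreover have "(?f has_vector_derivative 0) (at 0)"
    proof (rule has_vector_derivative_transform_within_open[where S="{-\<epsilon><..<\<epsilon>}"])
      show "((\<lambda>t. 0::real) has_vector_derivative 0) (at 0)" by simp
      show "0 = ?f t" if "t \<in> {-\<epsilon><..<\<epsilon>}" for t
        using grad[OF straightening_inverse_in[OF S VL[OF that]]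
            chart_derivative_in_tangent_space[OF S VL[OF that] \<open>a \<in> L\<close>]]
        by (simp add: inner_diff_left)
    qed (use \<epsilon> in auto)
    ultimately show ?thesis
      using vector_derivative_unique_at by fastforce
  qed
  obtain a where a: "a \<in> L" "?D a u = X"
    using tangent_space_subset_chart_derivative[OF S \<open>q \<in> U\<close> tan(1)] unfolding u_def by metis
  obtain b where b: "b \<in> L" "?D b u = X'"
    using tangent_space_subset_chart_derivative[OF S \<open>q \<in> U\<close> tan(2)] unfolding u_def by metis
  show ?thesis
    using eq[OF a(1) b(1)] eq[OF b(1) a(1)] a b
      smooth_on_mixed_derivatives_commute[OF smooth \<open>open V\<close> u(1), of a b] by simp
qed

text \<open>Differentiate \<open>Y \<bullet> Y = 1\<close> along a curve in \<open>M\<close> with velocity \<open>X\<close>.\<close>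

lemma unit_field_derivative_orthogonal:
  assumes "(Y has_derivative A) (at q within M)"
    and unit: "\<And>p. p \<in> M \<Longrightarrow> norm (Y p) = 1"
    and "X \<in> tangent_space M q"
  shows "A X \<bullet> Y q = 0"
proof -
  from assms(3) obtain \<gamma> \<epsilon> where \<gamma>: "0 < \<epsilon>" "\<gamma> ` {-\<epsilon><..<\<epsilon>} \<subseteq> M"
      "\<gamma> 0 = q" "(\<gamma> has_vector_derivative X) (at 0)"
    unfolding tangent_space_def by blast
  have "((\<lambda>t. Y (\<gamma> t)) has_vector_derivative A X) (at 0)"
    by (rule derivative_along_curve_in[where I="{-\<epsilon><..<\<epsilon>}" and M=M, rotated])
      (use assms(1) \<gamma> in auto)
  then have "((\<lambda>t. Y (\<gamma> t) \<bullet> Y (\<gamma> t)) has_vector_derivative 2 * (A X \<bullet> Y q)) (at 0)"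
    unfolding has_vector_derivative_def
    by (auto intro!: derivative_eq_intros simp: \<gamma> algebra_simps inner_commute)
  moreover have "((\<lambda>t. Y (\<gamma> t) \<bullet> Y (\<gamma> t)) has_vector_derivative 0) (at 0)"
  proof (rule has_vector_derivative_transform_within_open[where S="{-\<epsilon><..<\<epsilon>}"])
    show "((\<lambda>t. 1::real) has_vector_derivative 0) (at 0)" by simp
    show "1 = Y (\<gamma> t) \<bullet> Y (\<gamma> t)" if "t \<in> {-\<epsilon><..<\<epsilon>}" for t
    proof -
      have "\<gamma> t \<in> M" using \<gamma>(2) that by blast
      then show ?thesis by (simp add: dot_square_norm unit)
    qed
  qed (use \<gamma> in auto)
  ultimately show ?thesis using vector_derivative_unique_at by fastforce
qed

text \<open>The orthogonal projection is a definite description, so its value \<open>0\<close> at a normal vector has to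
  be shown to be the only candidate.\<close>

lemma normal_component_of_normal:
  assumes "0 \<in> tangent_space M q" "x \<in> normal_space M q"
  shows "normal_component M q x = x"
proof -
  have "orth_proj (tangent_space M q) x = 0"
    unfolding orth_proj_def
  proof (rule the_equality)
    show "0 \<in> tangent_space M q \<and> x - 0 \<in> orthogonal_comp (tangent_space M q)"
      using assms by (simp add: normal_space_def)
    show "y = 0" if "y \<in> tangent_space M q \<and> x - y \<in> orthogonal_comp (tangent_space M q)" for y
    proof -
      have "y \<bullet> x = 0" "y \<bullet> (x - y) = 0"
        using that assms by (auto simp: normal_space_def orthogonal_comp_def orthogonal_def)
      then show ?thesis by (simp add: inner_diff_right)
    qed
  qed
  then show ?thesis by (simp add: normal_component_def)
qed

lemma smooth_on_const: "smooth_on S (\<lambda>_. c)"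
proof -
  have "Ck_on k S (\<lambda>_. c)" for k
    by (induction k arbitrary: c) (auto simp: continuous_on_const)
  then show ?thesis by (simp add: smooth_on_def)
qed

lemma zero_in_tangent_space:
  assumes "q \<in> M" shows "0 \<in> tangent_space M q"
  unfolding tangent_space_def
  using assms smooth_on_const[of "{-1<..<1::real}" q]
  by (auto intro!: exI[of _ "\<lambda>_. q"] exI[of _ "1::real"])


section \<open>Straight curves\<close>

text \<open>On a line with direction \<open>u\<close> both velocity and acceleration are multiples of \<open>u\<close>; being also
  orthogonal, with the velocity nonzero, they force the acceleration to vanish.\<close>

lemma collinear_curve_acceleration:
  fixes \<gamma> v :: "real \<Rightarrow> 'a::euclidean_space"
  assumes "open J" "t \<in> J" "collinear (\<gamma> ` J)"
    and \<gamma>: "\<And>s. s \<in> J \<Longrightarrow> (\<gamma> has_vector_derivative v s) (at s)"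
    and v: "(v has_vector_derivative a) (at t)"
    and "v t \<noteq> 0" "a \<bullet> v t = 0"
  shows "a = 0"
proof -
  obtain u where u: "\<And>x y. \<lbrakk>x \<in> \<gamma> ` J; y \<in> \<gamma> ` J\<rbrakk> \<Longrightarrow> \<exists>c. x - y = c *\<^sub>R u"
    using \<open>collinear (\<gamma> ` J)\<close> unfolding collinear_def by blast
  let ?L = "span {u}"
  have sub: "\<gamma> s - \<gamma> t \<in> ?L" if "s \<in> J" for s
    using u[of "\<gamma> s" "\<gamma> t"] that \<open>t \<in> J\<close> by (auto simp: span_breakdown_eq)
  have vs: "v s \<in> ?L" if "s \<in> J" for s
  proof (rule derivative_in_subspace[OF subspace_span \<open>open J\<close> that sub])
    show "((\<lambda>s. \<gamma> s - \<gamma> t) has_vector_derivative v s) (at s)"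
      using \<gamma>[OF that] by (auto intro!: derivative_eq_intros)
  qed
  have "a \<in> ?L"
    by (rule derivative_in_subspace[OF subspace_span \<open>open J\<close> \<open>t \<in> J\<close> vs v])
  with vs[OF \<open>t \<in> J\<close>] obtain c c' where "v t = c *\<^sub>R u" "a = c' *\<^sub>R u"
    by (auto simp: span_singleton)
  with assms(6,7) show ?thesis by auto
qed

text \<open>The velocity is constant on the interval, hence so is \<open>\<gamma> s - s v\<close>.\<close>

lemma zero_acceleration_in_straight_line:
  fixes \<gamma> v :: "real \<Rightarrow> 'a::euclidean_space"
  assumes "is_interval J"
    and \<gamma>: "\<And>s. s \<in> J \<Longrightarrow> (\<gamma> has_vector_derivative v s) (at s)"
    and v: "\<And>s. s \<in> J \<Longrightarrow> (v has_vector_derivative 0) (at s)"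
    and "t \<in> J" "v t \<noteq> 0"
  shows "in_straight_line (\<gamma> ` J)"
proof -
  have "convex J" using \<open>is_interval J\<close> by (simp add: is_interval_convex)
  have const: "v s = v t" if "s \<in> J" for s
    by (rule has_derivative_zero_unique[OF \<open>convex J\<close> _ that \<open>t \<in> J\<close>])
      (use v in \<open>auto simp: has_vector_derivative_def intro: has_derivative_at_withinI\<close>)
  have affine: "\<gamma> s - s *\<^sub>R v t = \<gamma> t - t *\<^sub>R v t" if "s \<in> J" for s
  proof (rule has_derivative_zero_unique[OF \<open>convex J\<close> _ that \<open>t \<in> J\<close>])
    fix r assume "r \<in> J"
    have "((\<lambda>s. \<gamma> s - s *\<^sub>R v t) has_vector_derivative v r - v t) (at r)"
      using \<gamma>[OF \<open>r \<in> J\<close>] by (auto intro!: derivative_eq_intros)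
    then show "((\<lambda>s. \<gamma> s - s *\<^sub>R v t) has_derivative (\<lambda>_. 0)) (at r within J)"
      using const[OF \<open>r \<in> J\<close>] by (auto simp: has_vector_derivative_def intro: has_derivative_at_withinI)
  qed
  let ?L = "affine hull {\<gamma> t, \<gamma> t + v t}"
  have "\<gamma> s \<in> ?L" if "s \<in> J" for s
  proof -
    have "\<gamma> s = (1 - (s - t)) *\<^sub>R \<gamma> t + (s - t) *\<^sub>R (\<gamma> t + v t)"
      using affine[OF that] by (simp add: algebra_simps)
    then show ?thesis unfolding affine_hull_2 by force
  qed
  moreover have "aff_dim ?L = 1" using \<open>v t \<noteq> 0\<close> by simp
  ultimately show ?thesis unfolding in_straight_line_def
    by (intro exI[of _ ?L]) (auto simp: affine_affine_hull)
qed


section \<open>Helix lines\<close>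

text \<open>Helix lines are geodesics of \<open>M\<close>. Since \<open>\<xi>\<close> is normal, pairing the decomposition of \<open>d\<close> with a
  tangent vector \<open>X\<close> leaves \<open>d \<bullet> X = cos \<theta> (T \<bullet> X)\<close>, so \<open>T\<close> is the gradient of
  \<open>x \<mapsto> (d \<bullet> x) / cos \<theta>\<close>. Symmetry of the Hessian and unit length then give
  \<open>D\<^sub>T T \<bullet> X = D\<^sub>X T \<bullet> T = 0\<close>.\<close>

lemma helix_covariant_derivative_normal:
  assumes "submanifold k M" "helix M d \<theta>" "helix_directions M d \<theta> T \<xi>" "q \<in> M"
  shows "covariant_derivative M T T q \<in> normal_space M q"
proof -
  let ?A = "frechet_derivative T (at q within M)"
  from assms(3) have T: "smooth_field M T" "\<And>p. p \<in> M \<Longrightarrow> T p \<in> tangent_space M p"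
    and unit: "\<And>p. p \<in> M \<Longrightarrow> norm (T p) = 1"
    and \<xi>: "\<And>p. p \<in> M \<Longrightarrow> \<xi> p \<in> normal_space M p"
    and d: "\<And>p. p \<in> M \<Longrightarrow> d = cos \<theta> *\<^sub>R T p + sin \<theta> *\<^sub>R \<xi> p"
    unfolding helix_directions_def tangent_field_def normal_field_def by blast+
  have A: "(T has_derivative ?A) (at q within M)"
    by (rule smooth_field_has_derivative[OF T(1) \<open>q \<in> M\<close>])
  have "cos \<theta> \<noteq> 0"
    using assms(2) cos_gt_zero[of \<theta>] by (simp add: helix_def)
  have grad: "T p \<bullet> X = (d /\<^sub>R cos \<theta>) \<bullet> X" if "p \<in> M" "X \<in> tangent_space M p" for p X
  proof -
    have "\<xi> p \<bullet> X = 0"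
      using \<xi>[OF that(1)] that(2)
      by (auto simp: normal_space_def orthogonal_comp_def orthogonal_def inner_commute)
    then have "d \<bullet> X = cos \<theta> * (T p \<bullet> X)"
      by (subst d[OF that(1)]) (simp add: inner_add_left)
    then show ?thesis using \<open>cos \<theta> \<noteq> 0\<close> by (simp add: field_simps)
  qed
  have "?A (T q) \<bullet> X = 0" if "X \<in> tangent_space M q" for X
    using gradient_derivative_symmetric[OF assms(1) \<open>q \<in> M\<close> A grad T(2)[OF \<open>q \<in> M\<close>] that]
      unit_field_derivative_orthogonal[OF A unit that] by simp
  then show ?thesis
    by (auto simp: covariant_derivative_def normal_space_def orthogonal_comp_def orthogonal_def
        inner_commute)
qed

theorem theorem3p8:
  fixes M :: "(real ^ 'n) set" and k :: nat
    and d :: "real ^ 'n" and \<theta> :: real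
    and T \<xi> :: "real ^ 'n \<Rightarrow> real ^ 'n"
  assumes "submanifold k M"
    and "full M"
    and "helix M d \<theta>"
    and "helix_directions M d \<theta> T \<xi>"
  shows "ruled_helix M d \<theta> T \<longleftrightarrow>
    (\<forall>J \<gamma>. helix_line M T J \<gamma> \<longrightarrow> (\<forall>t\<in>J. normal_curvature M T \<gamma> t = 0))"
proof -
  from assms(4) have T: "smooth_field M T" "\<And>p. p \<in> M \<Longrightarrow> T p \<in> tangent_space M p"
    and unit: "\<And>p. p \<in> M \<Longrightarrow> norm (T p) = 1"
    unfolding helix_directions_def tangent_field_def by blast+
  let ?a = "covariant_derivative M T T"
  have nonzero: "T p \<noteq> 0" if "p \<in> M" for p
    using unit[OF that] by auto
  have curvature: "normal_curvature M T \<gamma> t = norm (?a (\<gamma> t))" if "\<gamma> t \<in> M" for \<gamma> t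
    unfolding normal_curvature_def second_fundamental_form_def
    using normal_component_of_normal[OF zero_in_tangent_space[OF that]
        helix_covariant_derivative_normal[OF assms(1,3,4) that]] by simp
  have acceleration: "((\<lambda>s. T (\<gamma> s)) has_vector_derivative ?a (\<gamma> t)) (at t)"
    if "helix_line M T J \<gamma>" "t \<in> J" for J \<gamma> t
    unfolding covariant_derivative_def
    by (rule derivative_along_curve_in[where I=J and M=M, rotated])
      (use that in \<open>auto simp: helix_line_def intro: smooth_field_has_derivative T\<close>)
  have "in_straight_line (\<gamma> ` J) \<longleftrightarrow> (\<forall>t\<in>J. normal_curvature M T \<gamma> t = 0)"
    if line: "helix_line M T J \<gamma>" for J \<gamma>
  proof -
    from line have "open J" "is_interval J" "J \<noteq> {}" and in_M: "\<And>t. t \<in> J \<Longrightarrow> \<gamma> t \<in> M"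
      and velocity: "\<And>t. t \<in> J \<Longrightarrow> (\<gamma> has_vector_derivative T (\<gamma> t)) (at t)"
      unfolding helix_line_def by auto
    have "in_straight_line (\<gamma> ` J) \<longleftrightarrow> (\<forall>t\<in>J. ?a (\<gamma> t) = 0)"
    proof
      assume "in_straight_line (\<gamma> ` J)"
      then have "collinear (\<gamma> ` J)"
        unfolding in_straight_line_def by (metis collinear_aff_dim collinear_subset order_refl)
      show "\<forall>t\<in>J. ?a (\<gamma> t) = 0"
      proof
        fix t assume "t \<in> J"
        have "?a (\<gamma> t) \<bullet> T (\<gamma> t) = 0"
          unfolding covariant_derivative_def
          using smooth_field_has_derivative[OF T(1) in_M[OF \<open>t \<in> J\<close>]] unit T(2)[OF in_M[OF \<open>t \<in> J\<close>]]
          by (rule unit_field_derivative_orthogonal)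
        then show "?a (\<gamma> t) = 0"
          using collinear_curve_acceleration[OF \<open>open J\<close> \<open>t \<in> J\<close> \<open>collinear (\<gamma> ` J)\<close> velocity
              acceleration[OF line \<open>t \<in> J\<close>]] nonzero[OF in_M[OF \<open>t \<in> J\<close>]] by blast
      qed
    next
      assume zero: "\<forall>t\<in>J. ?a (\<gamma> t) = 0"
      from \<open>J \<noteq> {}\<close> obtain t where "t \<in> J" by blast
      have "((\<lambda>s. T (\<gamma> s)) has_vector_derivative 0) (at s)" if "s \<in> J" for s
        using acceleration[OF line that] zero that by simp
      then show "in_straight_line (\<gamma> ` J)"
        using zero_acceleration_in_straight_line[OF \<open>is_interval J\<close> velocity _ \<open>t \<in> J\<close>
            nonzero[OF in_M[OF \<open>t \<in> J\<close>]]] by blast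
    qed
    then show ?thesis using curvature in_M by simp
  qed
  then show ?thesis using assms(3) unfolding ruled_helix_def by blast
qed

end
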